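(* Let $\mathrm H_n$ be the $(2n+1)$-dimensional Heisenberg Lie group with its canonical left-invariant metric, $\mathfrak h_n=\mathfrak v\oplus\mathfrak z$ its Lie algebra, and $J\in\mathfrak{so}(\mathfrak v)$ as in the context. Then the map $$A\longmapsto \psi(A):=JA$$ is a bijection between the set of quadratic first integrals $g_A$ of the geodesic flow on $T\mathrm H_n$ (identified with the corresponding symmetric maps $A:\mathfrak v\to\mathfrak v$) and the Lie algebra of skew-symmetric derivations of $\mathfrak h_n$. Moreover, for quadratic first integrals $g_{A_1},g_{A_2}$ one has $\{g_{A_1},g_{A_2}\}=0$ if and only if $[\psi(A_1),\psi(A_2)]=0$ in $\mathfrak{so}(\mathfrak v,\langle\cdot,\cdot\rangle_{\mathfrak v})$.
   Context: The Heisenberg group $\mathrm H_n$ is $\mathbb R^{2n}\times\mathbb R$ with product $(v,z)(v',z')=(v+v',\,z+z'-\tfrac12 v^{\tau}Jv')$, where $J$ is the linear map of $\mathbb R^{2n}\simeq\mathbb C^n$ given by multiplication by $i$ ($Je_{2k-1}=e_{2k}$, $Je_{2k}=-e_{2k-1}$). Its Lie algebra $\mathfrak h_n$ has basis $X_1,\dots,X_{2n},Z_1$ with nonzero brackets $[X_{2i-1},X_{2i}]=Z_1$, $i=1,\dots,n$. The canonical metric is the left-invariant Riemannian metric $\langle\cdot,\cdot\rangle$ for which this basis is orthonormal. Put $\mathfrak v=\mathrm{span}(X_1,\dots,X_{2n})$, $\mathfrak z=\mathbb RZ_1$ (the center). On $\mathfrak v$, $J$ is the skew-symmetric map with $\langle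 JU,V\rangle=\langle[U,V],Z_1\rangle$, i.e. $JX_{2i-1}=X_{2i}$, $JX_{2i}=-X_{2i-1}$. For a Lie group $N$ with left-invariant metric and Lie algebra $\mathfrak n$ (here $N=\mathrm H_n$): $TN$ is identified with $N\times\mathfrak n$, where $(p,Y)$ stands for $dL_p(Y)$, and $T_{(p,Y)}(TN)$ with $\mathfrak n\times\mathfrak n$, where $(U,V)$ is the initial velocity of $t\mapsto(p\exp(tU),Y+tV)$. The canonical symplectic form is $\Omega_{(p,Y)}((U,V),(U',V'))=\langle U,V'\rangle-\langle V,U'\rangle+\langle Y,[U,U']\rangle$. The Hamiltonian vector field $X_f$ is defined by $df=\Omega(X_f,\cdot)$, and $\{f,g\}=\Omega(X_f,X_g)$. The energy is $\mathrm E(p,Y)=\frac12\langle Y,Y\rangle$; its Hamiltonian flow is the geodesic flow, and $f$ is a first integral of the geodesic flow if $\{f,\mathrm E\}=0$. A quadratic first integral is a function $g_A:T\mathrm H_n\to\mathbb R$, $g_A(p,Y)=\langle AY,Y\rangle$, with $A:\mathfrak v\to\mathfrak v$ symmetric and extended to $\mathfrak h_n$ by $AZ_1=0$, which is a first integral of the geodesic flow. The Lie algebra of skew-symmetric derivations of $\mathfrak h_n$ is identified, via restriction to $\mathfrak v$ (such derivations vanish on $\mathfrak z$), with $\mathfrak k=\{B\in\mathfrak{so}(\mathfrak v,\langle\cdot,\cdot\rangle_{\mathfrak v}): [J,B]=0\}$. *)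

theory Defs
  imports "HOL-Analysis.Analysis"
begin

text \<open>
  We use R^{2n} = C^n, so that the type \<open>complex ^ 'n\<close> with \<open>CARD('n) = n\<close> (hence \<open>n \<ge> 1\<close>)
  is the Euclidean space R^{2n}: its inner product is the real one, and the orthonormal basis is
  e_{2k-1} = \<open>axis k 1\<close>, e_{2k} = \<open>axis k \<i>\<close>.  The words \<open>linear\<close> and
  \<open>\<bullet>\<close> below always refer to this real structure.

  The same type serves for the group H_n (global coordinates) and for its Lie algebra, the tangent
  space at the neutral element \<open>0\<close>.  In the Lie algebra, X_{2k-1} = \<open>(axis k 1, 0)\<close>,
  X_{2k} = \<open>(axis k \<i>, 0)\<close> and Z_1 = \<open>(0, 1)\<close>.  The library inner product of the product
  type makes this basis orthonormal, so it is the canonical metric.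
\<close>

type_synonym 'n heis = "(complex ^ 'n) \<times> real"

definition J :: "complex ^ 'n \<Rightarrow> complex ^ 'n::finite" where
  "J v = (\<chi> k. \<i> * v $ k)"

definition heis_mult :: "'n::finite heis \<Rightarrow> 'n heis \<Rightarrow> 'n heis" where
  "heis_mult p q = (fst p + fst q, snd p + snd q - (1/2) * (fst p \<bullet> J (fst q)))"

definition heis_bracket :: "'n::finite heis \<Rightarrow> 'n heis \<Rightarrow> 'n heis" where
  "heis_bracket U V = (0, J (fst U) \<bullet> fst V)"

definition one_param_subgroup :: "'n::finite heis \<Rightarrow> (real \<Rightarrow> 'n heis) \<Rightarrow> bool" where
  "one_param_subgroup U \<gamma> \<longleftrightarrow>
     (\<forall>s t. \<gamma> (s + t) = heis_mult (\<gamma> s) (\<gamma> t)) \<and> (\<gamma> has_vector_derivative U) (at 0)"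

definition heis_exp :: "'n::finite heis \<Rightarrow> 'n heis" where
  "heis_exp U = (THE \<gamma>. one_param_subgroup U \<gamma>) 1"


lemma J_axis: "J (axis k 1) = axis k \<i>" "J (axis k \<i>) = - axis k 1"
  by (simp_all add: J_def axis_def vec_eq_iff)

lemma linear_J: "linear J"
  by (rule linearI) (simp_all add: J_def vec_eq_iff algebra_simps)

lemma J_skew: "J u \<bullet> v = - (u \<bullet> J v)"
  by (simp add: J_def inner_vec_def inner_complex_def flip: sum_negf)

lemma J_J: "J (J v) = - v"
  by (simp add: J_def vec_eq_iff flip: mult.assoc)

lemma heis_bracket_basis:
  "heis_bracket (axis k 1, 0) (axis l \<i>, 0) = (0, if k = l then 1 else 0)"
  "heis_bracket (axis k 1, 0) (axis l 1, 0) = 0"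
  "heis_bracket (axis k \<i>, 0) (axis l \<i>, 0) = 0"
  "heis_bracket (0, 1) V = 0"
  by (simp_all add: heis_bracket_def J_axis inner_axis_axis inner_complex_def zero_prod_def
        linear_0[OF linear_J])

text \<open>The bracket is the one induced by the group law: p q = [p, q] q p.\<close>

lemma heis_mult_commutator:
  "heis_mult p q = heis_mult (heis_bracket p q) (heis_mult q p)"
proof -
  have "fst q \<bullet> J (fst p) = - (fst p \<bullet> J (fst q))"
    using J_skew[of "fst p" "fst q"] by (simp add: inner_commute)
  then show ?thesis
    by (simp add: heis_mult_def heis_bracket_def J_skew)
qed

lemma additive_deriv_unique:
  fixes f :: "real \<Rightarrow> 'a::real_normed_vector"
  assumes add: "\<And>s t. f (s + t) = f s + f t" and d: "(f has_vector_derivative D) (at 0)"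
  shows "f t = t *\<^sub>R D"
proof -
  have dall: "(f has_vector_derivative D) (at x)" for x
  proof -
    have "((\<lambda>y. y - x) has_vector_derivative 1) (at x)"
      by (auto intro!: derivative_eq_intros)
    then have "(f \<circ> (\<lambda>y. y - x) has_vector_derivative 1 *\<^sub>R D) (at x)"
      by (rule vector_diff_chain_at) (simp add: d)
    then have "((\<lambda>y. f x + f (y - x)) has_vector_derivative D) (at x)"
      by (auto intro!: derivative_eq_intros simp: o_def)
    moreover have "(\<lambda>y. f x + f (y - x)) = f" by (simp flip: add)
    ultimately show ?thesis by simp
  qed
  have "((\<lambda>y. f y - y *\<^sub>R D) has_vector_derivative 0) (at x)" for x
    by (rule derivative_eq_intros dall refl | simp)+
  then obtain c where c: "\<And>y. f y - y *\<^sub>R D = c"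
    using has_vector_derivative_zero_constant[of UNIV "\<lambda>y. f y - y *\<^sub>R D"] by auto
  have "f 0 = 0" using add[of 0 0] by simp
  with c[of 0] c[of t] show ?thesis by simp
qed

lemma one_param_subgroup_iff: "one_param_subgroup U \<gamma> \<longleftrightarrow> \<gamma> = (\<lambda>t. t *\<^sub>R U)"
proof
  have J0: "v \<bullet> J v = 0" for v :: "complex ^ 'n::finite"
    using J_skew[of v v] by (simp add: inner_commute)
  assume o: "one_param_subgroup U \<gamma>"
  then have m: "\<gamma> (s + t) = heis_mult (\<gamma> s) (\<gamma> t)" and d: "(\<gamma> has_vector_derivative U) (at 0)" for s t
    by (auto simp: one_param_subgroup_def)
  have f: "fst (\<gamma> t) = t *\<^sub>R fst U" for t
    by (rule additive_deriv_unique[where f = "\<lambda>t. fst (\<gamma> t)"])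
       (use m d bounded_linear.has_vector_derivative[OF bounded_linear_fst d] in
          \<open>auto simp: heis_mult_def\<close>)
  have s: "snd (\<gamma> t) = t *\<^sub>R snd U" for t
    by (rule additive_deriv_unique[where f = "\<lambda>t. snd (\<gamma> t)"])
       (use m d bounded_linear.has_vector_derivative[OF bounded_linear_snd d] in
          \<open>auto simp: heis_mult_def f linear_scale[OF linear_J] J0\<close>)
  show "\<gamma> = (\<lambda>t. t *\<^sub>R U)"
    by (auto simp: prod_eq_iff f s)
next
  have J0: "v \<bullet> J v = 0" for v :: "complex ^ 'n::finite"
    using J_skew[of v v] by (simp add: inner_commute)
  assume "\<gamma> = (\<lambda>t. t *\<^sub>R U)"
  then show "one_param_subgroup U \<gamma>"
    by (auto simp: one_param_subgroup_def heis_mult_def prod_eq_iff linear_scale[OF linear_J] J0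
        algebra_simps intro!: derivative_eq_intros)
qed

lemma heis_exp_eq: "heis_exp U = U"
  by (simp add: heis_exp_def one_param_subgroup_iff)


text \<open>
  TN is N \<times> n by left translation, with points \<open>(p, Y)\<close>; the tangent space at
  each point is n \<times> n, where \<open>(U, V)\<close> is the initial velocity of
  \<open>t \<mapsto> (p exp(tU), Y + tV)\<close>.
  Accordingly \<open>differential f x W\<close> is df_x(W), the derivative of \<open>f\<close> along that curve.
  It is meaningful for differentiable \<open>f\<close>; the energy and all \<open>quad_fun A\<close> with
  \<open>A\<close> linear are polynomial.
\<close>

type_synonym 'n theis = "'n heis \<times> 'n heis"

definition differential :: "('n::finite theis \<Rightarrow> real) \<Rightarrow> 'n theis \<Rightarrow> 'n theis \<Rightarrow> real" where
  "differential f x W = vector_derivative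
     (\<lambda>t. f (heis_mult (fst x) (heis_exp (t *\<^sub>R fst W)), snd x + t *\<^sub>R snd W)) (at 0)"

definition Omega :: "'n::finite theis \<Rightarrow> 'n theis \<Rightarrow> 'n theis \<Rightarrow> real" where
  "Omega x W W' = fst W \<bullet> snd W' - snd W \<bullet> fst W' + snd x \<bullet> heis_bracket (fst W) (fst W')"

text \<open>\<open>THE\<close> is justified for differentiable \<open>f\<close> because \<open>Omega x\<close> is nondegenerate.\<close>

definition ham_field :: "('n::finite theis \<Rightarrow> real) \<Rightarrow> 'n theis \<Rightarrow> 'n theis" where
  "ham_field f x = (THE W. \<forall>W'. differential f x W' = Omega x W W')"

definition poisson :: "('n::finite theis \<Rightarrow> real) \<Rightarrow> ('n theis \<Rightarrow> real) \<Rightarrow> 'n theis \<Rightarrow> real" where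
  "poisson f g x = Omega x (ham_field f x) (ham_field g x)"

definition energy :: "'n::finite theis \<Rightarrow> real" where
  "energy x = (1/2) * (snd x \<bullet> snd x)"

definition first_integral :: "('n::finite theis \<Rightarrow> real) \<Rightarrow> bool" where
  "first_integral f \<longleftrightarrow> (\<forall>x. poisson f energy x = 0)"


definition extend_zero :: "(complex ^ 'n::finite \<Rightarrow> complex ^ 'n) \<Rightarrow> 'n heis \<Rightarrow> 'n heis" where
  "extend_zero A Y = (A (fst Y), 0)"

definition quad_fun :: "(complex ^ 'n::finite \<Rightarrow> complex ^ 'n) \<Rightarrow> 'n theis \<Rightarrow> real" where
  "quad_fun A x = extend_zero A (snd x) \<bullet> snd x"

definition symmetric_map :: "('a::real_inner \<Rightarrow> 'a) \<Rightarrow> bool" where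
  "symmetric_map A \<longleftrightarrow> linear A \<and> (\<forall>u v. A u \<bullet> v = u \<bullet> A v)"

definition skew_symmetric_map :: "('a::real_inner \<Rightarrow> 'a) \<Rightarrow> bool" where
  "skew_symmetric_map B \<longleftrightarrow> linear B \<and> (\<forall>u v. B u \<bullet> v = - (u \<bullet> B v))"

definition quadratic_first_integrals :: "(complex ^ 'n::finite \<Rightarrow> complex ^ 'n) set" where
  "quadratic_first_integrals = {A. symmetric_map A \<and> first_integral (quad_fun A)}"

definition skew_derivations :: "('n::finite heis \<Rightarrow> 'n heis) set" where
  "skew_derivations = {D. skew_symmetric_map D \<and>
     (\<forall>U V. D (heis_bracket U V) = heis_bracket (D U) V + heis_bracket U (D V))}"

text \<open>
  Taking \<open>fst\<close> loses nothing: by \<open>skew_derivations_eq\<close> below, skew-symmetric derivations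
  map \<open>v\<close> to \<open>v\<close> and vanish on the center.
\<close>

definition restrict_v :: "('n::finite heis \<Rightarrow> 'n heis) \<Rightarrow> complex ^ 'n \<Rightarrow> complex ^ 'n" where
  "restrict_v D v = fst (D (v, 0))"

definition commutator :: "('a::ab_group_add \<Rightarrow> 'a) \<Rightarrow> ('a \<Rightarrow> 'a) \<Rightarrow> 'a \<Rightarrow> 'a" where
  "commutator B C v = B (C v) - C (B v)"

definition \<psi> :: "(complex ^ 'n::finite \<Rightarrow> complex ^ 'n) \<Rightarrow> complex ^ 'n \<Rightarrow> complex ^ 'n" where
  "\<psi> A = J \<circ> A"

definition \<kk> :: "(complex ^ 'n::finite \<Rightarrow> complex ^ 'n) set" where
  "\<kk> = {B. skew_symmetric_map B \<and> commutator J B = (\<lambda>_. 0)}"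

lemma extend_zero_skew_derivation:
  assumes "B \<in> \<kk>"
  shows "extend_zero B \<in> skew_derivations"
proof -
  have lin: "linear B" and sk: "B u \<bullet> v = - (u \<bullet> B v)" and cm: "J (B v) = B (J v)" for u v
    using assms by (auto simp: \<kk>_def skew_symmetric_map_def commutator_def fun_eq_iff)
  have "linear (extend_zero B)"
    by (rule linearI) (simp_all add: extend_zero_def linear_add[OF lin] linear_scale[OF lin])
  moreover have "extend_zero B U \<bullet> V = - (U \<bullet> extend_zero B V)" for U V
    by (simp add: extend_zero_def inner_prod_def sk)
  moreover have "extend_zero B (heis_bracket U V)
      = heis_bracket (extend_zero B U) V + heis_bracket U (extend_zero B V)" for U V
    by (simp add: extend_zero_def heis_bracket_def linear_0[OF lin] cm sk)
  ultimately show ?thesis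
    by (simp add: skew_derivations_def skew_symmetric_map_def)
qed

lemma skew_derivationD:
  assumes "D \<in> skew_derivations"
  shows "restrict_v D \<in> \<kk>" and "D = extend_zero (restrict_v D)"
proof -
  have lin: "linear D" and sk: "D U \<bullet> V = - (U \<bullet> D V)"
    and der: "D (heis_bracket U V) = heis_bracket (D U) V + heis_bracket U (D V)" for U V
    using assms unfolding skew_derivations_def skew_symmetric_map_def by blast+
  let ?Z = "(0, 1) :: 'a heis"
  obtain k :: 'a where True by simp
  have "D ?Z = D (heis_bracket (axis k 1, 0) (axis k \<i>, 0))"
    by (simp add: heis_bracket_basis)
  then have "fst (D ?Z) = 0"
    unfolding der by (simp add: heis_bracket_def)
  moreover have "snd (D ?Z) = 0"
    using sk[of ?Z ?Z] by (simp add: inner_prod_def)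
  ultimately have DZ: "D ?Z = 0" by (simp add: prod_eq_iff)
  have Dz: "D (0, z) = 0" for z
    using linear_scale[OF lin, of z ?Z] DZ by simp
  have Dv: "snd (D U) = 0" for U
    using sk[of U ?Z] DZ by (simp add: inner_prod_def)
  have "D U = D (fst U, 0) + D (0, snd U)" for U
    using linear_add[OF lin, of "(fst U, 0)" "(0, snd U)"] by simp
  then show ext: "D = extend_zero (restrict_v D)"
    by (auto simp: fun_eq_iff extend_zero_def restrict_v_def prod_eq_iff Dz Dv)
  have linr: "linear (restrict_v D)"
  proof (rule linearI)
    fix u v :: "complex ^ 'a" and r :: real
    show "restrict_v D (u + v) = restrict_v D u + restrict_v D v"
      using linear_add[OF lin, of "(u, 0)" "(v, 0)"] by (simp add: restrict_v_def)
    show "restrict_v D (r *\<^sub>R u) = r *\<^sub>R restrict_v D u"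
      using linear_scale[OF lin, of r "(u, 0)"] by (simp add: restrict_v_def)
  qed
  have skr: "restrict_v D u \<bullet> v = - (u \<bullet> restrict_v D v)" for u v
    using sk[of "(u, 0)" "(v, 0)"] by (simp add: restrict_v_def inner_prod_def)
  have "J (restrict_v D u) \<bullet> v = restrict_v D (J u) \<bullet> v" for u v
    using der[of "(u, 0)" "(v, 0)"]
    by (simp add: restrict_v_def[symmetric] heis_bracket_def Dz skr prod_eq_iff)
  then have "J (restrict_v D u) = restrict_v D (J u)" for u
    by (meson vector_eq_rdot)
  then show "restrict_v D \<in> \<kk>"
    by (simp add: \<kk>_def skew_symmetric_map_def linr skr commutator_def fun_eq_iff)
qed

lemma skew_derivations_eq: "skew_derivations = extend_zero ` \<kk>"
  using extend_zero_skew_derivation skew_derivationD by blast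

lemma bij_betw_restrict_v: "bij_betw restrict_v skew_derivations \<kk>"
proof (rule bij_betw_byWitness[where f' = extend_zero])
  show "\<forall>D\<in>skew_derivations. extend_zero (restrict_v D) = D"
    using skew_derivationD(2) by metis
qed (use extend_zero_skew_derivation skew_derivationD(1) in
        \<open>auto simp: restrict_v_def extend_zero_def\<close>)

lemma inj_on_quad_fun: "inj_on quad_fun {A. symmetric_map A}"
proof (rule inj_onI, clarsimp)
  fix A B :: "complex ^ 'n::finite \<Rightarrow> complex ^ 'n"
  assume A: "symmetric_map A" and B: "symmetric_map B" and eq: "quad_fun A = quad_fun B"
  have linA: "linear A" and linB: "linear B"
    and sA: "A u \<bullet> v = A v \<bullet> u" and sB: "B u \<bullet> v = B v \<bullet> u" for u v
    using A B by (auto simp: symmetric_map_def inner_commute)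
  have q: "A u \<bullet> u = B u \<bullet> u" for u
    using fun_cong[OF eq, of "(0, (u, 0))"] by (simp add: quad_fun_def extend_zero_def)
  have "A u \<bullet> v = B u \<bullet> v" for u v
    using q[of "u + v"] q[of u] q[of v] sA[of v u] sB[of v u]
    by (simp add: linear_add[OF linA] linear_add[OF linB] inner_add_left inner_add_right)
  then show "A = B"
    by (metis ext vector_eq_rdot)
qed

end

theory Submission imports Defs begin

text \<open>
  A function of \<open>Y\<close> alone with gradient \<open>G\<close> at \<open>(p, Y)\<close> has Hamiltonian
  field \<open>(G, z J G)\<close> there, \<open>z\<close> being the central component of \<open>Y\<close>.  Writing \<open>v\<close> for the
  component of \<open>Y\<close> in \<open>\<vv>\<close>, this gives \<open>{g_A, E} = 2 z \<langle>A v, J v\<rangle>\<close> and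
  \<open>{g_A, g_B} = 4 z \<langle>A v, J B v\<rangle>\<close>.  Both vanish identically iff a bilinear form is
  alternating; for symmetric \<open>A\<close> and \<open>B\<close> the first condition says that \<open>J A\<close> is
  skew, equivalently that \<open>A\<close> commutes with \<open>J\<close>, and given this the second says that \<open>A\<close> and
  \<open>B\<close> commute.
\<close>

text \<open>Uniqueness is the nondegeneracy of \<open>Omega x\<close>: vertical test vectors
  \<open>(0, V)\<close> determine \<open>fst W\<close>, and then horizontal ones
  \<open>(U, 0)\<close> determine \<open>snd W\<close>.\<close>

lemma ham_field_eqI:
  assumes "\<And>W. differential f x W = G \<bullet> snd W"
  shows "ham_field f x = (G, (snd (snd x) *\<^sub>R J (fst G), 0))"
  unfolding ham_field_def
proof (rule the_equality)
  have *: "Omega x (G, (snd (snd x) *\<^sub>R J (fst G), 0)) W' = G \<bullet> snd W'" for W'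
    by (simp add: Omega_def heis_bracket_def inner_prod_def)
  then show "\<forall>W'. differential f x W' = Omega x (G, (snd (snd x) *\<^sub>R J (fst G), 0)) W'"
    by (simp add: assms)
  fix W assume "\<forall>W'. differential f x W' = Omega x W W'"
  then have W: "Omega x W W' = G \<bullet> snd W'" for W'
    using assms by metis
  have "fst W \<bullet> V = G \<bullet> V" for V
    using W[of "(0, V)"] by (simp add: Omega_def heis_bracket_def inner_prod_def linear_0[OF linear_J])
  then have fst_W: "fst W = G"
    by (meson vector_eq_rdot)
  have "snd W \<bullet> U = (snd (snd x) *\<^sub>R J (fst G), 0) \<bullet> U" for U
    using W[of "(U, 0)"] fst_W by (simp add: Omega_def heis_bracket_def inner_prod_def)
  then have "snd W = (snd (snd x) *\<^sub>R J (fst G), 0)"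
    by (meson vector_eq_rdot)
  with fst_W show "W = (G, (snd (snd x) *\<^sub>R J (fst G), 0))"
    by (simp add: prod_eq_iff)
qed

text \<open>In \<open>Omega\<close> the last two terms cancel, because the bracket term pairs
  \<open>J (fst F)\<close> with \<open>fst G\<close> just as the second one does.\<close>

lemma poisson_eq:
  assumes "\<And>W. differential f x W = F \<bullet> snd W" and "\<And>W. differential g x W = G \<bullet> snd W"
  shows "poisson f g x = snd (snd x) * (fst F \<bullet> J (fst G))"
  by (simp add: poisson_def ham_field_eqI[OF assms(1)] ham_field_eqI[OF assms(2)]
      Omega_def heis_bracket_def inner_prod_def)

text \<open>\<open>energy\<close> and \<open>quad_fun A\<close> ignore the base point, so along the
  curves of \<open>differential\<close> they are quadratic polynomials in \<open>t\<close>, and the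
  differential is the linear coefficient.\<close>

lemma vector_derivative_quadratic:
  fixes a b c :: real
  shows "vector_derivative (\<lambda>t. a + t * b + t * t * c) (at 0) = b"
  by (rule vector_derivative_at)
     (auto intro!: derivative_eq_intros simp flip: has_real_derivative_iff_has_vector_derivative)

lemma differential_energy: "differential energy x W = snd x \<bullet> snd W"
proof -
  have "(\<lambda>t. energy (heis_mult (fst x) (heis_exp (t *\<^sub>R fst W)), snd x + t *\<^sub>R snd W))
      = (\<lambda>t. energy x + t * (snd x \<bullet> snd W) + t * t * (snd W \<bullet> snd W / 2))"
    by (simp add: energy_def fun_eq_iff inner_add_left inner_add_right inner_commute algebra_simps)
  then show ?thesis
    by (simp only: differential_def vector_derivative_quadratic)
qed

lemma differential_quad_fun:
  assumes "symmetric_map A"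
  shows "differential (quad_fun A) x W = (2 *\<^sub>R A (fst (snd x)), 0) \<bullet> snd W"
proof -
  have lin: "linear A" and sym: "A u \<bullet> v = A v \<bullet> u" for u v
    using assms by (auto simp: symmetric_map_def inner_commute)
  let ?v = "fst (snd x)" and ?b = "fst (snd W)"
  have "(\<lambda>t. quad_fun A (heis_mult (fst x) (heis_exp (t *\<^sub>R fst W)), snd x + t *\<^sub>R snd W))
      = (\<lambda>t. A ?v \<bullet> ?v + t * (2 * (A ?v \<bullet> ?b)) + t * t * (A ?b \<bullet> ?b))"
    by (simp add: quad_fun_def extend_zero_def inner_prod_def fun_eq_iff linear_add[OF lin]
        linear_scale[OF lin] inner_add_left inner_add_right sym[of ?b ?v] algebra_simps)
  then show ?thesis
    by (simp add: differential_def vector_derivative_quadratic inner_prod_def del: mult.assoc)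
qed

lemma poisson_quad_fun_energy:
  assumes "symmetric_map A"
  shows "poisson (quad_fun A) energy x = 2 * snd (snd x) * (A (fst (snd x)) \<bullet> J (fst (snd x)))"
  by (simp add: poisson_eq[OF differential_quad_fun[OF assms] differential_energy])

lemma poisson_quad_fun:
  assumes "symmetric_map A" "symmetric_map B"
  shows "poisson (quad_fun A) (quad_fun B) x
    = 4 * snd (snd x) * (A (fst (snd x)) \<bullet> J (B (fst (snd x))))"
  by (simp add: poisson_eq[OF differential_quad_fun[OF assms(1)] differential_quad_fun[OF assms(2)]]
      linear_scale[OF linear_J])

text \<open>The central component varies independently of the component \<open>v\<close>, so it can
  be set to 1 and the factor in front of \<open>q\<close> disappears.\<close>

lemma ball_central_component_iff:
  fixes q :: "complex ^ 'n::finite \<Rightarrow> real"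
  assumes "c \<noteq> 0"
  shows "(\<forall>x :: 'n theis. c * snd (snd x) * q (fst (snd x)) = 0) \<longleftrightarrow> (\<forall>v. q v = 0)"
proof
  assume *: "\<forall>x :: 'n theis. c * snd (snd x) * q (fst (snd x)) = 0"
  show "\<forall>v. q v = 0"
    using *[rule_format, of "(0, (_, 1))"] assms by simp
qed simp

text \<open>Polarisation: expanding at \<open>u + v\<close> leaves only the two cross terms.
  Conversely, \<open>B v \<bullet> v\<close> equals its own negative.\<close>

lemma linear_alternating_iff_skew:
  assumes "linear B"
  shows "(\<forall>v. B v \<bullet> v = 0) \<longleftrightarrow> skew_symmetric_map B"
proof
  assume alt: "\<forall>v. B v \<bullet> v = 0"
  have "B u \<bullet> v = - (u \<bullet> B v)" for u v
    using alt[rule_format, of "u + v"] alt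
    by (simp add: linear_add[OF assms] inner_add_left inner_add_right inner_commute)
  with assms show "skew_symmetric_map B"
    by (simp add: skew_symmetric_map_def)
next
  assume "skew_symmetric_map B"
  then have "B v \<bullet> v = - (v \<bullet> B v)" for v
    by (simp add: skew_symmetric_map_def)
  then show "\<forall>v. B v \<bullet> v = 0"
    by (metis inner_commute equal_neg_zero)
qed

lemma J_eq_iff: "J u = J v \<longleftrightarrow> u = v"
  by (metis J_J neg_equal_iff_equal)

lemma linear_\<psi>: "linear A \<Longrightarrow> linear (\<psi> A)"
  unfolding \<psi>_def by (rule linear_compose[OF _ linear_J])

lemma first_integral_quad_fun_iff:
  assumes "symmetric_map A"
  shows "first_integral (quad_fun A) \<longleftrightarrow> skew_symmetric_map (\<psi> A)"
proof -
  have "linear (\<psi> A)"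
    using assms by (simp add: symmetric_map_def linear_\<psi>)
  have "first_integral (quad_fun A) \<longleftrightarrow> (\<forall>v. A v \<bullet> J v = 0)"
    unfolding first_integral_def poisson_quad_fun_energy[OF assms]
    by (rule ball_central_component_iff) simp
  also have "\<dots> \<longleftrightarrow> (\<forall>v. \<psi> A v \<bullet> v = 0)"
    by (simp add: \<psi>_def J_skew)
  finally show ?thesis
    by (simp add: linear_alternating_iff_skew[OF \<open>linear (\<psi> A)\<close>])
qed

text \<open>For symmetric \<open>A\<close> the adjoint of J A is -A J.\<close>

lemma skew_\<psi>_iff_commute:
  assumes "symmetric_map A"
  shows "skew_symmetric_map (\<psi> A) \<longleftrightarrow> (\<forall>v. A (J v) = J (A v))"
proof -
  have lin: "linear A" and sym: "A u \<bullet> v = u \<bullet> A v" for u v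
    using assms by (auto simp: symmetric_map_def)
  have "skew_symmetric_map (\<psi> A) \<longleftrightarrow> (\<forall>u v. u \<bullet> A (J v) = u \<bullet> J (A v))"
    using linear_\<psi>[OF lin] by (simp add: skew_symmetric_map_def \<psi>_def J_skew sym)
  also have "\<dots> \<longleftrightarrow> (\<forall>v. A (J v) = J (A v))"
    by (metis vector_eq_ldot)
  finally show ?thesis .
qed

lemma quadratic_first_integrals_eq:
  "quadratic_first_integrals = {A. symmetric_map A \<and> (\<forall>v. A (J v) = J (A v))}"
  by (auto simp: quadratic_first_integrals_def first_integral_quad_fun_iff skew_\<psi>_iff_commute)

lemma bij_betw_\<psi>: "bij_betw \<psi> quadratic_first_integrals \<kk>"
\<comment> \<open>Since J J = -1, left multiplication by J is undone by left multiplication by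
  -J.\<close>
proof (rule bij_betw_byWitness[where f' = "\<lambda>B v. - J (B v)"])
  show "\<psi> ` quadratic_first_integrals \<subseteq> \<kk>"
  proof (rule image_subsetI)
    fix A :: "complex ^ 'n \<Rightarrow> complex ^ 'n" assume "A \<in> quadratic_first_integrals"
    then have A: "symmetric_map A" "\<And>v. A (J v) = J (A v)"
      by (auto simp: quadratic_first_integrals_eq)
    then have "skew_symmetric_map (\<psi> A)"
      by (simp add: skew_\<psi>_iff_commute)
    then show "\<psi> A \<in> \<kk>"
      by (simp add: \<kk>_def commutator_def \<psi>_def fun_eq_iff A)
  qed
  \<comment> \<open>A product of two commuting skew maps is symmetric, and it commutes with J
    because both factors do.\<close>
  have "(\<lambda>v. - J (B v)) \<in> quadratic_first_integrals" if "B \<in> \<kk>" for B :: "complex ^ 'n \<Rightarrow> complex ^ 'n"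
  proof -
    have lin: "linear B" and sk: "B u \<bullet> v = - (u \<bullet> B v)" and cm: "B (J v) = J (B v)" for u v
      using that by (auto simp: \<kk>_def skew_symmetric_map_def commutator_def fun_eq_iff)
    have "linear (\<lambda>v. - J (B v))"
      using linear_compose_neg[OF linear_compose[OF lin linear_J]] by (simp add: o_def)
    moreover have "- J (B u) \<bullet> v = u \<bullet> - J (B v)" for u v
      by (simp add: J_skew sk cm)
    ultimately show ?thesis
      by (simp add: quadratic_first_integrals_eq symmetric_map_def cm linear_neg[OF linear_J])
  qed
  then show "(\<lambda>B v. - J (B v)) ` \<kk> \<subseteq> (quadratic_first_integrals :: (complex ^ 'n \<Rightarrow> complex ^ 'n) set)"
    by blast
qed (simp_all add: \<psi>_def fun_eq_iff J_J linear_neg[OF linear_J])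

lemma poisson_quad_fun_eq_zero_iff:
  assumes "A \<in> quadratic_first_integrals" "B \<in> quadratic_first_integrals"
  shows "(\<forall>x. poisson (quad_fun A) (quad_fun B) x = 0) \<longleftrightarrow> commutator (\<psi> A) (\<psi> B) = (\<lambda>_. 0)"
proof -
  have A: "symmetric_map A" "linear A" "A u \<bullet> v = u \<bullet> A v" "A (J v) = J (A v)"
    and B: "symmetric_map B" "linear B" "B u \<bullet> v = u \<bullet> B v" "B (J v) = J (B v)" for u v
    using assms by (auto simp: quadratic_first_integrals_eq symmetric_map_def)
  have lin: "linear (\<lambda>v. J (A (B v)))"
    using linear_compose[OF linear_compose[OF B(2) A(2)] linear_J] by (simp add: o_def)
  have "(\<forall>x. poisson (quad_fun A) (quad_fun B) x = 0) \<longleftrightarrow> (\<forall>v. A v \<bullet> J (B v) = 0)"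
    unfolding poisson_quad_fun[OF A(1) B(1)] by (rule ball_central_component_iff) simp
  also have "\<dots> \<longleftrightarrow> (\<forall>v. J (A (B v)) \<bullet> v = 0)"
    by (simp add: A inner_commute)
  \<comment> \<open>Polarisation turns the vanishing quadratic form into skewness of J A B. Its
    adjoint is -B A J = -J B A, so skewness amounts to J B A = J A B.\<close>
  also have "\<dots> \<longleftrightarrow> (\<forall>u v. J (A (B u)) \<bullet> v = - (u \<bullet> J (A (B v))))"
    using linear_alternating_iff_skew[OF lin] lin by (simp add: skew_symmetric_map_def)
  also have "\<dots> \<longleftrightarrow> (\<forall>u v. u \<bullet> J (B (A v)) = u \<bullet> J (A (B v)))"
    by (simp add: J_skew A B)
  also have "\<dots> \<longleftrightarrow> (\<forall>v. B (A v) = A (B v))"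
    by (metis vector_eq_ldot J_eq_iff)
  \<comment> \<open>As J commutes with both maps, J A J B = -A B, so the commutator of the images is
    -[A, B].\<close>
  also have "\<dots> \<longleftrightarrow> commutator (\<psi> A) (\<psi> B) = (\<lambda>_. 0)"
    by (simp add: commutator_def \<psi>_def fun_eq_iff A B J_J)
  finally show ?thesis .
qed

theorem theorem4p1:
  shows "bij_betw \<psi> (quadratic_first_integrals :: (complex ^ 'n::finite \<Rightarrow> complex ^ 'n) set)
           (restrict_v ` (skew_derivations :: ('n heis \<Rightarrow> 'n heis) set))
       \<and> (\<forall>A1 \<in> (quadratic_first_integrals :: (complex ^ 'n \<Rightarrow> complex ^ 'n) set).
          \<forall>A2 \<in> quadratic_first_integrals.
            (\<forall>x. poisson (quad_fun A1) (quad_fun A2) x = 0) \<longleftrightarrow>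
            commutator (\<psi> A1) (\<psi> A2) = (\<lambda>_. 0))"
  \<comment> \<open>This replaces the restricted derivations by \<open>\<kk>\<close>, the target
    used in \<open>bij_betw_\<psi>\<close>.\<close>
  unfolding bij_betw_imp_surj_on[OF bij_betw_restrict_v]
  by (intro conjI ballI bij_betw_\<psi> poisson_quad_fun_eq_zero_iff)

end
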